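(* Let $p\neq 2$ be a prime, let $n\geqslant 1$ be an integer, let $f(x)=x^{p-1}+x^{p-2}+\cdots+x+1\in\mathbb{F}_2[x]$, and let $f_i(x)$ be an irreducible factor of $f(x)$ over $\mathbb{F}_2$. For $N\geqslant 1$ let $\mathcal{C}_{p^N,\,0}$ denote the binary cyclic code of length $p^N$ with generator polynomial $f_i(x)$. Then the full automorphism group $\mathrm{Aut}\,\mathcal{C}_{p^n,\,0}$ of $\mathcal{C}_{p^n,\,0}$ is isomorphic to $$(\mathrm{S}_{p^{n-1}})^p : \mathrm{Aut}\,\mathcal{C}_{p,\,0},$$ where $\mathrm{Aut}\,\mathcal{C}_{p,\,0}$ is the full automorphism group of the code $\mathcal{C}_{p,\,0}$ of length $p$.
   Context: All polynomials are over $\mathbb{F}_2$. Note $f_i(x)$ divides $f(x)$, which divides $x^p-1$ and hence $x^{p^N}-1$ for all $N\geqslant1$. For $h(x)\in\mathbb{F}_2[x]$ dividing $x^L-1$, the binary cyclic code of length $L$ with generator polynomial $h$ is the set of all $(c_0,\dots,c_{L-1})\in\mathbb{F}_2^L$ such that $c_0+c_1x+\cdots+c_{L-1}x^{L-1}$ lies in the ideal generated by $h$ in $\mathbb{F}_2[x]/(x^L-1)$. For a code $\mathcal{C}$ of length $L$, an automorphism of $\mathcal{C}$ is a permutation of the $L$ coordinate positions that maps each codeword of $\mathcal{C}$ to a codeword of $\mathcal{C}$; the full automorphism group $\mathrm{Aut}\,\mathcal{C}\leqslant \mathrm{S}_L$ is the group of all of these under composition. $\mathrm{S}_k$ is the symmetric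 group of degree $k$, $A^k$ is the direct product of $k$ copies of $A$, and $A:B$ denotes a semidirect product (split extension) with normal subgroup $A$ and complement $B$. *)

theory Defs
  imports
    "HOL-Algebra.Bij"
    "HOL-Algebra.Product_Groups"
    "HOL-Algebra.Sym_Groups"
    "HOL-Library.Z2"
    "HOL-Computational_Algebra.Polynomial"
begin

(* The type bit of HOL-Library.Z2 is the field F_2. A word of length L over F_2 is a bit list
   [c_0, ..., c_(L-1)], and Poly c is the polynomial c_0 + c_1 x + ... + c_(L-1) x^(L-1).
   Two polynomials have the same class in F_2[x]/(x^L - 1) iff x^L - 1 divides their difference,
   so the condition below says that the class of Poly c is a multiple of the class of h. *)
definition cyclic_code :: "nat \<Rightarrow> bit poly \<Rightarrow> bit list set" where
  "cyclic_code L h =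
     {c. length c = L \<and>
         (\<exists>a. (Polynomial.monom 1 L - 1) dvd (Poly c - a * h))}"

(* permute_list s (c_0, ..., c_(L-1)) = (c_(s 0), ..., c_(s (L-1))). The opposite convention,
   moving the entry at position i to position s i, gives the same set of permutations, because
   this set is closed under inverses. *)
definition code_aut :: "nat \<Rightarrow> bit list set \<Rightarrow> (nat \<Rightarrow> nat) monoid" where
  "code_aut L C =
     \<lparr>carrier = {s. s permutes {..<L} \<and> (\<forall>c\<in>C. permute_list s c \<in> C)},
      monoid.mult = (\<circ>), one = id\<rparr>"

(* A split extension A : B with respect to an action phi of B on A by automorphisms;
   A is identified with the pairs (a, 1) and B with the pairs (1, b). *)
definition semidirect ::
  "('a, 'm) monoid_scheme \<Rightarrow> ('b, 'n) monoid_scheme \<Rightarrow> ('b \<Rightarrow> 'a \<Rightarrow> 'a) \<Rightarrow> ('a \<times> 'b) monoid" where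
  "semidirect A B \<phi> =
     \<lparr>carrier = carrier A \<times> carrier B,
      monoid.mult = (\<lambda>(a, b) (a', b'). (a \<otimes>\<^bsub>A\<^esub> \<phi> b a', b \<otimes>\<^bsub>B\<^esub> b')),
      one = (\<one>\<^bsub>A\<^esub>, \<one>\<^bsub>B\<^esub>)\<rparr>"

lemma group_code_aut:
  assumes len: "\<And>c. c \<in> C \<Longrightarrow> length c = L"
  shows "group (code_aut L C)"
proof (rule groupI)
  fix s t assume "s \<in> carrier (code_aut L C)" "t \<in> carrier (code_aut L C)"
  then show "s \<otimes>\<^bsub>code_aut L C\<^esub> t \<in> carrier (code_aut L C)"
    by (auto simp: code_aut_def permutes_compose permute_list_compose len)
next
  fix s assume s: "s \<in> carrier (code_aut L C)"
  then have p: "s permutes {..<L}" and sC: "\<And>c. c \<in> C \<Longrightarrow> permute_list s c \<in> C"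
    by (auto simp: code_aut_def)
  have "C \<subseteq> {c. set c \<subseteq> UNIV \<and> length c = L}" using len by auto
  moreover have "finite (UNIV :: bit set)"
    by (rule finite_subset[of _ "{0, 1}"]) (auto intro: bit.exhaust)
  ultimately have fin: "finite C"
    using finite_lists_length_eq finite_subset by metis
  have inv: "permute_list (inv_into UNIV s) (permute_list s c) = c" if "c \<in> C" for c
    using permute_list_compose[of "inv_into UNIV s" c s] permutes_inv[OF p] len[OF that]
    by (simp add: permutes_inv_o[OF p])
  have "inj_on (permute_list s) C" by (metis inj_onI inv)
  then have img: "permute_list s ` C = C"
    using fin sC by (intro endo_inj_surj) auto
  have "permute_list (inv_into UNIV s) c \<in> C" if "c \<in> C" for c
    using that img inv by (metis imageE)
  then have "inv_into UNIV s \<in> carrier (code_aut L C)"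
    using permutes_inv[OF p] by (auto simp: code_aut_def)
  then show "\<exists>t\<in>carrier (code_aut L C). t \<otimes>\<^bsub>code_aut L C\<^esub> s = \<one>\<^bsub>code_aut L C\<^esub>"
    using permutes_inv_o[OF p] by (auto simp: code_aut_def)
qed (auto simp: code_aut_def permutes_id comp_assoc)

lemma group_semidirect:
  assumes A: "group A" and B: "group B" and phi: "\<phi> \<in> hom B (AutoGroup A)"
  shows "group (semidirect A B \<phi>)"
proof -
  interpret A: group A by fact
  interpret B: group B by fact
  interpret P: group_hom B "AutoGroup A" \<phi>
    using phi A.AutoGroup B by (simp add: group_hom_def group_hom_axioms_def)
  have aut: "\<phi> b \<in> Group.hom A A" "\<phi> b \<in> Bij (carrier A)" if "b \<in> carrier B" for b
    using P.hom_closed[OF that] by (auto simp: AutoGroup_def auto_def)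
  have cl: "\<phi> b a \<in> carrier A" if "b \<in> carrier B" "a \<in> carrier A" for a b
    using aut(1)[OF that(1)] that(2) by (auto simp: hom_def)
  have hm: "\<phi> b (a \<otimes>\<^bsub>A\<^esub> a') = \<phi> b a \<otimes>\<^bsub>A\<^esub> \<phi> b a'"
    if "b \<in> carrier B" "a \<in> carrier A" "a' \<in> carrier A" for a a' b
    using aut(1)[OF that(1)] that(2,3) by (auto simp: hom_def)
  have cm: "\<phi> (b \<otimes>\<^bsub>B\<^esub> b') a = \<phi> b (\<phi> b' a)"
    if "b \<in> carrier B" "b' \<in> carrier B" "a \<in> carrier A" for a b b'
    using P.hom_mult[OF that(1,2)] aut(2) that
    by (simp add: AutoGroup_def BijGroup_def compose_def)
  have on: "\<phi> \<one>\<^bsub>B\<^esub> a = a" if "a \<in> carrier A" for a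
    using P.hom_one that by (simp add: AutoGroup_def BijGroup_def)
  show ?thesis
  proof (rule groupI)
    fix x assume "x \<in> carrier (semidirect A B \<phi>)"
    then obtain a b where x: "x = (a, b)" "a \<in> carrier A" "b \<in> carrier B"
      by (auto simp: semidirect_def)
    show "\<exists>y\<in>carrier (semidirect A B \<phi>).
            y \<otimes>\<^bsub>semidirect A B \<phi>\<^esub> x = \<one>\<^bsub>semidirect A B \<phi>\<^esub>"
      by (rule bexI[of _ "(inv\<^bsub>A\<^esub> (\<phi> (inv\<^bsub>B\<^esub> b) a), inv\<^bsub>B\<^esub> b)"])
         (use x cl in \<open>auto simp: semidirect_def simp del: P.hom_inv\<close>)
  qed (auto simp: semidirect_def cl hm cm on A.m_assoc B.m_assoc simp del: P.hom_mult P.hom_one)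
qed

end

theory Submission
  imports Defs "HOL-Computational_Algebra.Primes"
begin

text \<open>
  Since \<open>p\<close> is odd, \<open>x - 1\<close> does not divide \<open>f\<close>, so \<open>x\<close> has order exactly \<open>p\<close> modulo \<open>f\<^sub>i\<close>.
  Hence the word supported on two positions \<open>u \<noteq> v\<close> is a codeword of \<open>C\<close>, the code of length
  \<open>p\<^sup>n\<close>, iff \<open>u\<close> and \<open>v\<close> are congruent modulo \<open>p\<close>, and every automorphism of \<open>C\<close> permutes the
  residue classes modulo \<open>p\<close>.  Summing a word over these classes gives a word of length \<open>p\<close> which
  lies in the short code iff the original word lies in \<open>C\<close>.  So a permutation preserving the
  partition into classes is an automorphism of \<open>C\<close> iff the permutation it induces on the \<open>p\<close>
  classes is an automorphism of the short code, while its action inside the classes is arbitrary.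
\<close>

section \<open>The order of x modulo a factor of f\<close>

lemma minus_one_dvd_power_minus_one: "x - 1 dvd x ^ k - (1 :: 'a :: comm_ring_1)"
proof (induction k)
  case (Suc k)
  have "x ^ Suc k - 1 = x * (x ^ k - 1) + (x - 1)" by (simp add: algebra_simps)
  then show ?case using Suc by (metis dvd_add dvd_mult dvd_refl)
qed simp

lemma dvd_monom_mult_minus_one:
  fixes h :: "'a :: comm_ring_1 poly"
  assumes "h dvd Polynomial.monom 1 p - 1"
  shows "h dvd Polynomial.monom 1 (p * k) - 1"
  using dvd_trans[OF assms minus_one_dvd_power_minus_one[of "Polynomial.monom 1 p" k]]
  by (simp add: monom_power)

text \<open>Modulo \<open>h\<close> the power x^p is 1, so only exponents modulo \<open>p\<close>
  matter there.\<close>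

lemma dvd_monom_minus_monom_mod:
  fixes h :: "'a :: comm_ring_1 poly"
  assumes "h dvd Polynomial.monom 1 p - 1"
  shows "h dvd Polynomial.monom c i - Polynomial.monom c (i mod p)"
proof -
  have "Polynomial.monom c i - Polynomial.monom c (i mod p) =
      Polynomial.monom c (i mod p) * (Polynomial.monom 1 (p * (i div p)) - 1)"
    by (simp add: right_diff_distrib mult_monom)
  then show ?thesis using dvd_monom_mult_minus_one[OF assms] by simp
qed

lemma geometric_sum_dvd_monom_minus_one:
  "(\<Sum>k<p. Polynomial.monom 1 k) dvd Polynomial.monom 1 p - (1 :: 'a :: comm_ring_1 poly)"
  using power_diff_1_eq[of "Polynomial.monom (1 :: 'a) 1" p] by (simp add: monom_power)

text \<open>If x^d were 1 modulo \<open>h\<close> for some \<open>d\<close> prime to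
  \<open>p\<close>, Bezout would make x itself 1 modulo \<open>h\<close>. The sum of
  \<open>p\<close> powers of x would then be \<open>p\<close> modulo \<open>h\<close>, which is 1 in
  characteristic two because \<open>p\<close> is odd, so \<open>h\<close> would be a unit.\<close>

lemma dvd_monom_minus_one_iff:
  fixes h :: "bit poly"
  assumes p: "Factorial_Ring.prime p" "p \<noteq> 2" and h: "\<not> is_unit h" "h dvd (\<Sum>k<p. Polynomial.monom 1 k)"
  shows "h dvd Polynomial.monom 1 d - 1 \<longleftrightarrow> p dvd d"
proof
  note hp = dvd_trans[OF h(2) geometric_sum_dvd_monom_minus_one]
  then show "h dvd Polynomial.monom 1 d - 1" if "p dvd d"
    using that dvd_monom_mult_minus_one[OF hp] by (auto simp: dvd_def)
  assume hd: "h dvd Polynomial.monom 1 d - 1"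
  show "p dvd d"
  proof (rule ccontr)
    assume nd: "\<not> p dvd d"
    then have "coprime d p" using p by (metis coprime_commute prime_imp_coprime)
    moreover have "d \<noteq> 0" using nd by (metis dvd_0_right)
    ultimately obtain u v where uv: "d * u = p * v + 1"
      using bezout_nat[of d p] by (auto simp: coprime_iff_gcd_eq_1)
    \<comment> \<open>Both x^(d*u) and x^(p*v) are 1 modulo \<open>h\<close>, so this identity
      leaves only x - 1.\<close>
    have "Polynomial.monom 1 (d * u) - 1 =
        Polynomial.monom 1 1 * (Polynomial.monom 1 (p * v) - 1) + (Polynomial.monom 1 1 - (1 :: bit poly))"
      by (simp add: uv algebra_simps mult_monom)
    then have hx: "h dvd Polynomial.monom 1 1 - 1"
      using dvd_monom_mult_minus_one[OF hd, of u] dvd_monom_mult_minus_one[OF hp, of v]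
      by (metis dvd_add_right_iff dvd_mult)
    have "h dvd (\<Sum>k<p. Polynomial.monom 1 k - 1)"
      using dvd_monom_mult_minus_one[OF hx] by (intro dvd_sum) simp
    then have "h dvd (\<Sum>k<p. Polynomial.monom 1 k) - of_nat p"
      by (simp add: sum_subtractf)
    then have "h dvd of_nat p"
      using h(2) by (metis dvd_diff_right_iff)
    moreover have "odd p" using p by (metis primes_dvd_imp_eq two_is_prime_nat)
    then have "of_nat p = (1 :: bit poly)"
      by (auto simp: of_nat_poly elim!: oddE)
    ultimately show False using h(1) by simp
  qed
qed

section \<open>Code membership and folding a long word to length p\<close>

text \<open>As \<open>h\<close> divides x^L - 1, reduction modulo x^L - 1 does not affect
  divisibility by \<open>h\<close>. This replaces the quotient ring by divisibility in F_2[x] from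
  here on.\<close>

lemma cyclic_code_iff:
  assumes "h dvd Polynomial.monom 1 L - 1"
  shows "c \<in> cyclic_code L h \<longleftrightarrow> length c = L \<and> h dvd Poly c"
proof -
  have "h dvd Poly c" if "Polynomial.monom 1 L - 1 dvd Poly c - a * h" for a
    using dvd_add[OF dvd_trans[OF assms that] dvd_triv_right[of h a]] by simp
  moreover have "\<exists>a. Polynomial.monom 1 L - 1 dvd Poly c - a * h" if "h dvd Poly c"
  proof -
    obtain a where "Poly c = a * h" using \<open>h dvd Poly c\<close> by (metis dvd_def mult.commute)
    then have "Poly c - a * h = 0" by simp
    then show ?thesis by (metis dvd_0_right)
  qed
  ultimately show ?thesis by (auto simp: cyclic_code_def)
qed

lemma Poly_eq_sum_monom: "Poly c = (\<Sum>i<length c. Polynomial.monom (c ! i) i)"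
  by (rule poly_eqI) (simp add: coeff_sum nth_default_def if_distrib cong: if_cong)

text \<open>For a word of length \<open>p * m\<close> this is reduction of its polynomial modulo x^p
  - 1.\<close>

definition fold_word :: "nat \<Rightarrow> nat \<Rightarrow> bit list \<Rightarrow> bit list" where
  "fold_word p m c = map (\<lambda>j. \<Sum>k<m. c ! (j + p * k)) [0..<p]"

lemma length_fold_word [simp]: "length (fold_word p m c) = p"
  by (simp add: fold_word_def)

lemma add_mult_less:
  fixes j k m p :: nat
  assumes "j < p" "k < m"
  shows "j + p * k < p * m"
proof -
  have "p * Suc k \<le> p * m" using assms(2) by (intro mult_le_mono2) simp
  then show ?thesis using assms(1) by simp
qed

lemma residue_less: "i < p * m \<Longrightarrow> i mod p < (p :: nat)"
  by (cases p) auto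

lemma quotient_less: "i < p * m \<Longrightarrow> i div p < (m :: nat)"
  by (simp add: less_mult_imp_div_less mult.commute)

lemma sum_by_residues:
  fixes g :: "nat \<Rightarrow> 'a :: comm_monoid_add"
  shows "(\<Sum>i<p * m. g i) = (\<Sum>j<p. \<Sum>k<m. g (j + p * k))"
  unfolding sum.cartesian_product
  by (rule sum.reindex_bij_witness[of _ "\<lambda>(j, k). j + p * k" "\<lambda>i. (i mod p, i div p)"])
    (auto simp: add_mult_less residue_less quotient_less)

text \<open>The two polynomials differ by a sum of terms c_i (x^i - x^(i mod p)), and
  \<open>h\<close> divides each of them.\<close>

lemma dvd_Poly_fold_word:
  assumes h: "h dvd Polynomial.monom 1 p - 1" and len: "length c = p * m"
  shows "h dvd Poly (fold_word p m c) \<longleftrightarrow> h dvd Poly c"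
proof -
  have "Poly (fold_word p m c) = (\<Sum>j<p. \<Sum>k<m. Polynomial.monom (c ! (j + p * k)) j)"
    unfolding Poly_eq_sum_monom
    by (simp add: fold_word_def monom_sum)
  also have "\<dots> = (\<Sum>i<p * m. Polynomial.monom (c ! i) (i mod p))"
    unfolding sum_by_residues by simp
  finally have "Poly c - Poly (fold_word p m c) =
      (\<Sum>i<p * m. Polynomial.monom (c ! i) i - Polynomial.monom (c ! i) (i mod p))"
    by (simp add: Poly_eq_sum_monom[of c] len sum_subtractf)
  then have "h dvd Poly c - Poly (fold_word p m c)"
    by (simp add: dvd_sum dvd_monom_minus_monom_mod[OF h])
  then show ?thesis by (metis dvd_diff_right_iff dvd_diff_left_iff)
qed


lemma cyclic_code_fold_word:
  assumes h: "h dvd Polynomial.monom 1 p - 1" and len: "length c = p * m"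
  shows "c \<in> cyclic_code (p * m) h \<longleftrightarrow> fold_word p m c \<in> cyclic_code p h"
  using dvd_Poly_fold_word[OF assms] len
  by (simp add: cyclic_code_iff h dvd_monom_mult_minus_one)

section \<open>Codewords of weight two and preservation of residue classes\<close>

lemma dvd_monom_minus_monom_iff:
  fixes h :: "bit poly"
  assumes p: "Factorial_Ring.prime p" "p \<noteq> 2" and h: "\<not> is_unit h" "h dvd (\<Sum>k<p. Polynomial.monom 1 k)"
  shows "h dvd Polynomial.monom 1 u - Polynomial.monom 1 v \<longleftrightarrow> u mod p = v mod p"
proof (induction u v rule: linorder_wlog)
  case (le u v)
  note hp = dvd_trans[OF h(2) geometric_sum_dvd_monom_minus_one]
  show ?case
  proof
    assume "u mod p = v mod p"
    then show "h dvd Polynomial.monom 1 u - Polynomial.monom 1 v"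
      using dvd_diff[OF dvd_monom_minus_monom_mod[OF hp, of 1 u] dvd_monom_minus_monom_mod[OF hp, of 1 v]]
      by simp
  next
    assume "h dvd Polynomial.monom 1 u - Polynomial.monom 1 v"
    \<comment> \<open>Modulo \<open>h\<close> the power x^(u(p-1)) is inverse to x^u, as x^(p*u) is
      1 there. Multiplying by it strips the common factor x^u and leaves x^(v-u) - 1.\<close>
    then have "h dvd Polynomial.monom 1 (u * (p - 1)) * (Polynomial.monom 1 v - Polynomial.monom 1 u)"
      by (metis dvd_mult dvd_minus_iff minus_diff_eq)
    moreover have "Polynomial.monom 1 (u * (p - 1)) * (Polynomial.monom 1 v - Polynomial.monom 1 u) =
        (Polynomial.monom 1 (v - u) - 1) * (Polynomial.monom 1 (p * u) - 1) + (Polynomial.monom 1 (v - u) - (1 :: bit poly))"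
    proof -
      have "u * (p - 1) + u = p * u"
        using p(1) by (cases p) auto
      moreover from this have "u * (p - 1) + v = (v - u) + p * u"
        using le by linarith
      ultimately show ?thesis
        by (simp only: right_diff_distrib left_diff_distrib mult_monom mult_1 mult_1_right) simp
    qed
    ultimately have "h dvd Polynomial.monom 1 (v - u) - 1"
      using dvd_monom_mult_minus_one[OF hp, of u] by (metis dvd_add_right_iff dvd_mult)
    then show "u mod p = v mod p"
      using dvd_monom_minus_one_iff[OF assms] le by (metis mod_eq_dvd_iff_nat)
  qed
next
  case (sym u v)
  then show ?case by (metis dvd_minus_iff minus_diff_eq)
qed

definition pair_word :: "nat \<Rightarrow> nat \<Rightarrow> nat \<Rightarrow> bit list" where
  "pair_word L u v = map (\<lambda>i. if i = u \<or> i = v then 1 else 0) [0..<L]"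

lemma pair_word_in_cyclic_code_iff:
  assumes p: "Factorial_Ring.prime p" "p \<noteq> 2" and h: "\<not> is_unit h" "h dvd (\<Sum>k<p. Polynomial.monom 1 k)"
    and uv: "u < p * m" "v < p * m" "u \<noteq> v"
  shows "pair_word (p * m) u v \<in> cyclic_code (p * m) h \<longleftrightarrow> u mod p = v mod p"
proof -
  note hp = dvd_trans[OF h(2) geometric_sum_dvd_monom_minus_one]
  \<comment> \<open>Signs do not matter over F_2. Positions must be distinct here: for
    \<open>u = v\<close> the word has weight one, whereas the difference vanishes.\<close>
  have "Poly (pair_word (p * m) u v) = Polynomial.monom 1 u - Polynomial.monom 1 v"
    using uv by (intro poly_eqI) (auto simp: pair_word_def nth_default_def)
  then show ?thesis
    by (simp add: cyclic_code_iff dvd_monom_mult_minus_one[OF hp] dvd_monom_minus_monom_iff[OF p h])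
      (simp add: pair_word_def)
qed

text \<open>\<open>permute_list t\<close> puts at position \<open>i\<close> the entry from
  \<open>t i\<close>, so ones move along the inverse of \<open>t\<close>, which is
  \<open>s\<close>.\<close>

lemma permute_list_pair_word:
  assumes "s permutes {..<L}" "t permutes {..<L}" "\<And>i. t (s i) = i"
  shows "permute_list t (pair_word L u v) = pair_word L (s u) (s v)"
proof -
  have "s (t i) = i" for i using surjD[OF permutes_surj[OF assms(1)], of i] assms(3) by metis
  then have "t i = u \<longleftrightarrow> i = s u" for i u using assms(3) by metis
  then show ?thesis
    using permutes_in_image[OF assms(2)]
    by (intro nth_equalityI) (auto simp: pair_word_def permute_list_def)
qed

text \<open>The carrier of \<open>code_aut\<close> only asks that codewords go to codewords; that
  the inverse permutation does so too comes from the group structure.\<close>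

lemma code_aut_cyclic_code_inverse:
  assumes "s \<in> carrier (code_aut L (cyclic_code L h))"
  obtains t where "t \<in> carrier (code_aut L (cyclic_code L h))" "\<And>i. t (s i) = i" "\<And>i. s (t i) = i"
proof -
  interpret group "code_aut L (cyclic_code L h)"
    by (rule group_code_aut) (simp add: cyclic_code_def)
  let ?t = "inv\<^bsub>code_aut L (cyclic_code L h)\<^esub> s"
  have "?t \<circ> s = id" "s \<circ> ?t = id"
    using l_inv[OF assms] r_inv[OF assms] by (simp_all add: code_aut_def)
  then show ?thesis
    using that[of ?t] inv_closed[OF assms] by (simp add: fun_eq_iff)
qed

text \<open>The inverse automorphism \<open>t\<close> carries the weight-two codeword at
  \<open>u\<close>, \<open>v\<close> to the one at \<open>s u\<close>, \<open>s v\<close>, which is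
  therefore a codeword as well.\<close>

lemma code_aut_preserves_mod:
  assumes p: "Factorial_Ring.prime p" "p \<noteq> 2" and h: "\<not> is_unit h" "h dvd (\<Sum>k<p. Polynomial.monom 1 k)"
    and s: "s \<in> carrier (code_aut (p * m) (cyclic_code (p * m) h))"
    and uv: "u < p * m" "v < p * m" "u mod p = v mod p"
  shows "s u mod p = s v mod p"
proof (cases "u = v")
  case False
  obtain t where t: "t \<in> carrier (code_aut (p * m) (cyclic_code (p * m) h))" "\<And>i. t (s i) = i"
    using code_aut_cyclic_code_inverse[OF s] by metis
  have perm: "s permutes {..<p * m}" "t permutes {..<p * m}"
    using s t by (auto simp: code_aut_def)
  have "permute_list t (pair_word (p * m) u v) \<in> cyclic_code (p * m) h"
    using t(1) uv False by (auto simp: code_aut_def pair_word_in_cyclic_code_iff[OF p h])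
  moreover have "s u \<noteq> s v" "s u < p * m" "s v < p * m"
    using False uv t(2) permutes_in_image[OF perm(1)] by (metis, auto)
  ultimately show ?thesis
    by (simp add: permute_list_pair_word[OF perm t(2)] pair_word_in_cyclic_code_iff[OF p h])
qed simp

section \<open>Permutations assembled from a class permutation and inner permutations\<close>

text \<open>The position \<open>j + p * k\<close> is the \<open>k\<close>-th element of class \<open>j\<close>; the shifts by one are needed
  because \<open>sym_group m\<close> acts on \<open>{1..m}\<close>.\<close>
definition wreath_perm :: "nat \<Rightarrow> nat \<Rightarrow> (nat \<Rightarrow> nat \<Rightarrow> nat) \<Rightarrow> (nat \<Rightarrow> nat) \<Rightarrow> nat \<Rightarrow> nat" where
  "wreath_perm p m a b i =
     (if i < p * m then b (i mod p) + p * (a (b (i mod p)) (Suc (i div p)) - 1) else i)"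

text \<open>The inner permutation is indexed by the target class \<open>b j\<close>: classes move
  first and are permuted internally afterwards. This fits the factorization of a pair (a, b) in
  \<open>semidirect\<close> as (a, 1) times (1, b).\<close>

lemma wreath_perm_apply:
  "j < p \<Longrightarrow> k < m \<Longrightarrow> wreath_perm p m a b (j + p * k) = b j + p * (a (b j) (Suc k) - 1)"
  by (simp add: wreath_perm_def add_mult_less)

lemma less_residues_cases:
  assumes "i < p * (m :: nat)"
  obtains j k where "i = j + p * k" "j < p" "k < m"
  using that[of "i mod p" "i div p"] assms by (simp add: residue_less quotient_less)

text \<open>Values of \<open>q\<close> on {1..m} are positive, so the truncated subtraction loses
  nothing.\<close>

lemma permutes_Suc_range:
  assumes "q permutes {1..m}" "k < m"
  shows "q (Suc k) - 1 < m" "Suc (q (Suc k) - 1) = q (Suc k)"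
  using permutes_in_image[OF assms(1), of "Suc k"] assms(2) by auto

lemma permutes_lessThan:
  assumes "b permutes {..<p :: nat}" "j < p" shows "b j < p"
  using permutes_in_image[OF assms(1)] assms(2) by auto

lemma add_mult_eq_iff:
  "j < p \<Longrightarrow> j' < p \<Longrightarrow> j + p * k = j' + p * k' \<longleftrightarrow> j = j' \<and> k = (k' :: nat)"
  by (metis add_left_cancel mod_less mod_mult_self2 mult_cancel1 not_less0)

lemma bij_betw_shift_perm:
  assumes "q permutes {1..m}"
  shows "bij_betw (\<lambda>k. q (Suc k) - 1) {..<m} {..<m}"
proof -
  have "inj_on (\<lambda>k. q (Suc k) - 1) {..<m}"
    using permutes_Suc_range(2)[OF assms] permutes_inj[OF assms]
    by (auto intro!: inj_onI) (metis Suc_inject injD)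
  moreover have "(\<lambda>k. q (Suc k) - 1) ` {..<m} \<subseteq> {..<m}"
    using permutes_Suc_range(1)[OF assms] by auto
  ultimately show ?thesis by (simp add: bij_betw_def endo_inj_surj)
qed

lemma wreath_perm_permutes:
  assumes b: "b permutes {..<p}" and a: "\<And>j. j < p \<Longrightarrow> a j permutes {1..m}"
  shows "wreath_perm p m a b permutes {..<p * m}"
proof (rule bij_imp_permutes)
  have "inj_on (wreath_perm p m a b) {..<p * m}"
  proof (rule inj_onI)
    fix x y assume "x \<in> {..<p * m}" "y \<in> {..<p * m}"
      and eq: "wreath_perm p m a b x = wreath_perm p m a b y"
    then obtain j k j' k' where
      xy: "x = j + p * k" "j < p" "k < m" "y = j' + p * k'" "j' < p" "k' < m"
      by (metis less_residues_cases lessThan_iff)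
    then have "b j = b j'" "a (b j) (Suc k) - 1 = a (b j') (Suc k') - 1"
      using eq unfolding xy(1,4) wreath_perm_apply[OF xy(2,3)] wreath_perm_apply[OF xy(5,6)]
        add_mult_eq_iff[OF permutes_lessThan[OF b xy(2)] permutes_lessThan[OF b xy(5)]] by blast+
    moreover from this have "j = j'" using permutes_inj[OF b] by (auto dest: injD)
    ultimately have "k = k'"
      using xy bij_betw_imp_inj_on[OF bij_betw_shift_perm[OF a[OF permutes_lessThan[OF b xy(2)]]]]
      by (auto dest: inj_onD)
    with \<open>j = j'\<close> show "x = y" using xy by simp
  qed
  moreover have "wreath_perm p m a b ` {..<p * m} \<subseteq> {..<p * m}"
    by (auto elim!: less_residues_cases simp: wreath_perm_apply simp del: One_nat_def
        intro!: add_mult_less permutes_lessThan[OF b] permutes_Suc_range(1)[OF a])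
  ultimately show "bij_betw (wreath_perm p m a b) {..<p * m} {..<p * m}"
    by (simp add: bij_betw_def endo_inj_surj)
qed (simp add: wreath_perm_def)

text \<open>The sum over a class ignores the order of its entries, so the inner permutations
  disappear under folding.\<close>

lemma fold_word_permute_wreath_perm:
  assumes b: "b permutes {..<p}" and a: "\<And>j. j < p \<Longrightarrow> a j permutes {1..m}"
    and len: "length c = p * m"
  shows "fold_word p m (permute_list (wreath_perm p m a b) c) = permute_list b (fold_word p m c)"
proof (rule nth_equalityI)
  fix j assume "j < length (fold_word p m (permute_list (wreath_perm p m a b) c))"
  then have j: "j < p" by simp
  have "fold_word p m (permute_list (wreath_perm p m a b) c) ! j =
      (\<Sum>k<m. c ! (b j + p * (a (b j) (Suc k) - 1)))"
    using j len wreath_perm_permutes[OF b a]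
    by (simp add: fold_word_def permute_list_nth add_mult_less wreath_perm_apply)
  also have "\<dots> = (\<Sum>k<m. c ! (b j + p * k))"
    using bij_betw_shift_perm[OF a[OF permutes_lessThan[OF b j]]]
    by (rule sum.reindex_bij_betw)
  also have "\<dots> = permute_list b (fold_word p m c) ! j"
    using j b permutes_lessThan[OF b j] by (simp add: permute_list_nth) (simp add: fold_word_def)
  finally show "fold_word p m (permute_list (wreath_perm p m a b) c) ! j =
      permute_list b (fold_word p m c) ! j" .
qed simp

text \<open>Padding with zeros is a right inverse of folding, so every word of length
  \<open>p\<close> lifts to length \<open>p * m\<close>.\<close>

lemma fold_word_append_zeros:
  assumes "length c = p" "m > 0"
  shows "fold_word p m (c @ replicate (p * m - p) 0) = c"
proof (rule nth_equalityI)
  fix j assume "j < length (fold_word p m (c @ replicate (p * m - p) 0))"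
  then have j: "j < p" by simp
  have "(c @ replicate (p * m - p) 0) ! (j + p * k) = (if k = 0 then c ! j else 0)" if "k < m" for k
    using add_mult_less[OF j that] j assms by (cases k) (auto simp: nth_append)
  then show "fold_word p m (c @ replicate (p * m - p) 0) ! j = c ! j"
    using j assms by (simp add: fold_word_def)
qed (simp add: assms)

text \<open>Folding carries the action of the long permutation to that of \<open>b\<close> and
  reflects code membership. Since every short codeword lifts to a long codeword, the two invariance
  conditions agree.\<close>

lemma wreath_perm_in_code_aut_iff:
  assumes h: "h dvd Polynomial.monom 1 p - 1" and m: "m > 0"
    and b: "b permutes {..<p}" and a: "\<And>j. j < p \<Longrightarrow> a j permutes {1..m}"
  shows "wreath_perm p m a b \<in> carrier (code_aut (p * m) (cyclic_code (p * m) h)) \<longleftrightarrow>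
    b \<in> carrier (code_aut p (cyclic_code p h))" (is "?l \<longleftrightarrow> ?r")
proof -
  have iff: "permute_list (wreath_perm p m a b) c \<in> cyclic_code (p * m) h \<longleftrightarrow>
      permute_list b (fold_word p m c) \<in> cyclic_code p h" if "length c = p * m" for c
    using that by (simp add: cyclic_code_fold_word[OF h] fold_word_permute_wreath_perm[OF b a])
  show ?thesis
  proof
    assume ?r
    have "permute_list (wreath_perm p m a b) c \<in> cyclic_code (p * m) h"
      if c: "c \<in> cyclic_code (p * m) h" for c
    proof -
      have len: "length c = p * m" using c by (simp add: cyclic_code_def)
      then have "fold_word p m c \<in> cyclic_code p h" using c cyclic_code_fold_word[OF h] by simp
      then show ?thesis using \<open>?r\<close> iff[OF len] by (simp add: code_aut_def)
    qed
    then show ?l using wreath_perm_permutes[OF b a] by (simp add: code_aut_def)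
  next
    assume l: ?l
    have "permute_list b c \<in> cyclic_code p h" if c: "c \<in> cyclic_code p h" for c
    proof -
      let ?c = "c @ replicate (p * m - p) 0"
      have len: "length c = p" "length ?c = p * m"
        using c m by (cases m; simp add: cyclic_code_def)+
      have "?c \<in> cyclic_code (p * m) h"
        using cyclic_code_fold_word[OF h len(2)] c fold_word_append_zeros[OF len(1) m] by simp
      then have "permute_list (wreath_perm p m a b) ?c \<in> cyclic_code (p * m) h"
        using l by (simp add: code_aut_def)
      then show ?thesis
        using iff[OF len(2)] fold_word_append_zeros[OF len(1) m] by simp
    qed
    then show ?r using b by (simp add: code_aut_def)
  qed
qed


section \<open>Every automorphism of the long code has exactly one such form\<close>

lemma code_aut_wreath_permE:
  assumes p: "Factorial_Ring.prime p" "p \<noteq> 2" and h: "\<not> is_unit h" "h dvd (\<Sum>k<p. Polynomial.monom 1 k)"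
    and m: "m > 0"
    and s: "s \<in> carrier (code_aut (p * m) (cyclic_code (p * m) h))"
  obtains a b where "a \<in> (\<Pi>\<^sub>E j\<in>{..<p}. {q. q permutes {1..m}})" "b permutes {..<p}"
    "s = wreath_perm p m a b"
proof -
  note mod = code_aut_preserves_mod[OF p h]
  obtain t where t: "t \<in> carrier (code_aut (p * m) (cyclic_code (p * m) h))" "\<And>i. t (s i) = i"
    using code_aut_cyclic_code_inverse[OF s] by metis
  have sp: "s permutes {..<p * m}" using s by (simp add: code_aut_def)
  note s_less = permutes_lessThan[OF sp]
  \<comment> \<open>The class of the image is read off at the representative \<open>j\<close>; every
    other member of the class gives the same value.\<close>
  define b where "b j = (if j < p then s j mod p else j)" for j
  \<comment> \<open>Component \<open>j\<close> belongs to the target class, so the source class is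
    \<open>inv_into UNIV b j\<close>. The shifts translate between indices from 0 and the set
    {1..m}, and the outer restriction makes the family extensional.\<close>
  define a where "a = (\<lambda>j\<in>{..<p}. \<lambda>k. if k \<in> {1..m} then Suc (s (inv_into UNIV b j + p * (k - 1)) div p) else k)"
  have j0: "j < p * m" if "j < p" for j
    using add_mult_less[OF that m] by simp
  have b: "b permutes {..<p}"
  proof (rule bij_imp_permutes)
    have "inj_on b {..<p}"
    proof (rule inj_onI)
      fix j j' assume "j \<in> {..<p}" "j' \<in> {..<p}" "b j = b j'"
      \<comment> \<open>The inverse \<open>t\<close> preserves classes too, so distinct classes
        cannot merge under \<open>s\<close>.\<close>
      then have "t (s j) mod p = t (s j') mod p" "j < p" "j' < p"
        using mod[OF t(1)] s_less j0 by (auto simp: b_def)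
      then show "j = j'" by (simp add: t(2))
    qed
    moreover have "b ` {..<p} \<subseteq> {..<p}"
      by (auto simp: b_def intro: mod_less_divisor)
    ultimately show "bij_betw b {..<p} {..<p}" by (simp add: bij_betw_def endo_inj_surj)
  qed (simp add: b_def)
  have inv_b: "inv_into UNIV b j < p" "b (inv_into UNIV b j) = j" if "j < p" for j
    using permutes_lessThan[OF permutes_inv[OF b] that] permutes_inverses(1)[OF b] by auto
  have s_mod: "s (j + p * k) mod p = b j" if "j < p" "k < m" for j k
    using mod[OF s, of "j + p * k" j] that by (simp add: add_mult_less j0 b_def)
  have a: "a j permutes {1..m}" if j: "j < p" for j
  proof (rule bij_imp_permutes)
    let ?s = "\<lambda>k. s (inv_into UNIV b j + p * k)"
    have s_j: "?s k < p * m" "?s k mod p = j" if "k < m" for k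
      using s_mod[OF inv_b(1)[OF j] that] inv_b(2)[OF j] s_less add_mult_less[OF inv_b(1)[OF j] that]
      by auto
    have "inj_on (a j) {1..m}"
    proof (rule inj_onI)
      fix k k' assume k: "k \<in> {1..m}" "k' \<in> {1..m}" "a j k = a j k'"
      then have "k - 1 < m" "k' - 1 < m" by auto
      moreover have "?s (k - 1) div p = ?s (k' - 1) div p"
        using k j by (simp add: a_def)
      \<comment> \<open>Both values have residue \<open>j\<close>, so equal quotients force equal
        positions.\<close>
      ultimately have "?s (k - 1) = ?s (k' - 1)"
        using s_j(2) by (metis mult_div_mod_eq)
      then have "k - 1 = k' - 1"
        using permutes_inj[OF sp] j by (auto dest!: injD)
      then show "k = k'" using k by auto
    qed
    moreover have "a j ` {1..m} \<subseteq> {1..m}"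
    proof
      fix x assume "x \<in> a j ` {1..m}"
      then obtain k where "k \<in> {1..m}" "x = Suc (?s (k - 1) div p)" using j by (auto simp: a_def)
      moreover from this have "k - 1 < m" by auto
      ultimately show "x \<in> {1..m}" using quotient_less[OF s_j(1)] by (auto simp: Suc_le_eq)
    qed
    ultimately show "bij_betw (a j) {1..m} {1..m}" by (simp add: bij_betw_def endo_inj_surj)
  qed (use j in \<open>auto simp: a_def\<close>)
  have "s i = wreath_perm p m a b i" for i
  proof (cases "i < p * m")
    case True
    then obtain j k where i: "i = j + p * k" "j < p" "k < m" by (rule less_residues_cases)
    have "wreath_perm p m a b i = b j + p * (s i div p)"
      using i by (simp add: wreath_perm_apply a_def permutes_lessThan[OF b] permutes_inverses(2)[OF b] Suc_le_eq)
    then show ?thesis using s_mod[OF i(2,3)] i(1) by (metis mod_mult_div_eq)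
  next
    case False
    then show ?thesis using permutes_not_in[OF sp] by (simp add: wreath_perm_def)
  qed
  moreover have "a \<in> (\<Pi>\<^sub>E j\<in>{..<p}. {q. q permutes {1..m}})"
    using a by (auto simp: a_def)
  ultimately show ?thesis using that b by blast
qed

text \<open>Residue and quotient of the image of \<open>j + p * k\<close> recover \<open>b j\<close>
  and the value of component \<open>b j\<close>. As \<open>m > 0\<close> every class is inhabited
  and shows \<open>b\<close>; as \<open>b\<close> is onto, every component is seen.\<close>

lemma wreath_perm_inject:
  assumes m: "m > 0"
    and a: "a \<in> (\<Pi>\<^sub>E j\<in>{..<p}. {q. q permutes {1..m}})" and b: "b permutes {..<p}"
    and a': "a' \<in> (\<Pi>\<^sub>E j\<in>{..<p}. {q. q permutes {1..m}})" and b': "b' permutes {..<p}"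
    and eq: "wreath_perm p m a b = wreath_perm p m a' b'"
  shows "a = a'" "b = b'"
proof -
  have *: "b j = b' j \<and> a (b j) (Suc k) - 1 = a' (b' j) (Suc k) - 1" if "j < p" "k < m" for j k
    using fun_cong[OF eq, of "j + p * k"] unfolding wreath_perm_apply[OF that]
      add_mult_eq_iff[OF permutes_lessThan[OF b that(1)] permutes_lessThan[OF b' that(1)]] .
  then have "b j = b' j" for j
    using m permutes_not_in[OF b] permutes_not_in[OF b'] by (cases "j < p") auto
  then show bb: "b = b'" by blast
  show "a = a'"
  proof (rule PiE_ext[OF a a'])
    fix j assume "j \<in> {..<p}"
    then have j: "j < p" by simp
    have perm: "a j permutes {1..m}" "a' j permutes {1..m}"
      using a a' j by auto
    have inv: "inv_into UNIV b j < p" "b (inv_into UNIV b j) = j"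
      using permutes_lessThan[OF permutes_inv[OF b] j] permutes_inverses(1)[OF b] by auto
    show "a j = a' j"
    proof
      fix k show "a j k = a' j k"
      proof (cases "k \<in> {1..m}")
        case True
        then obtain l where "k = Suc l" "l < m" by (cases k) auto
        then show ?thesis
          using *[OF inv(1)] inv(2) bb permutes_Suc_range(2)[OF perm(1)] permutes_Suc_range(2)[OF perm(2)]
          by metis
      qed (use permutes_not_in[OF perm(1)] permutes_not_in[OF perm(2)] in auto)
    qed
  qed
qed

section \<open>The action of class permutations on inner permutations\<close>

text \<open>This is conjugation by \<open>b\<close> inside the wreath product; the inverse makes it
  a left action. Both restrictions are there because elements of \<open>AutoGroup\<close> and of the
  product group are extensional functions.\<close>

definition shift_components :: "nat \<Rightarrow> nat \<Rightarrow> (nat \<Rightarrow> nat) \<Rightarrow> (nat \<Rightarrow> nat \<Rightarrow> nat) \<Rightarrow> nat \<Rightarrow> nat \<Rightarrow> nat" where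
  "shift_components p m b =
     (\<lambda>a \<in> (\<Pi>\<^sub>E j\<in>{..<p}. {q. q permutes {1..m}}). \<lambda>j\<in>{..<p}. a (inv_into UNIV b j))"

lemma shift_components_apply:
  assumes "a \<in> (\<Pi>\<^sub>E j\<in>{..<p}. {q. q permutes {1..m}})"
  shows "shift_components p m b a = (\<lambda>j\<in>{..<p}. a (inv_into UNIV b j))"
  using assms by (simp add: shift_components_def)

text \<open>In the product \<open>b\<close> has to move past \<open>a'\<close>. Conjugation by
  \<open>b\<close> takes the component at class \<open>j\<close> to class \<open>b j\<close>, which
  yields the multiplication of \<open>semidirect\<close>.\<close>

lemma wreath_perm_comp:
  assumes a: "a \<in> (\<Pi>\<^sub>E j\<in>{..<p}. {q. q permutes {1..m}})" and b: "b permutes {..<p}"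
    and a': "a' \<in> (\<Pi>\<^sub>E j\<in>{..<p}. {q. q permutes {1..m}})" and b': "b' permutes {..<p}"
  shows "wreath_perm p m a b \<circ> wreath_perm p m a' b' =
    wreath_perm p m (\<lambda>j\<in>{..<p}. a j \<circ> shift_components p m b a' j) (b \<circ> b')"
proof
  fix i
  show "(wreath_perm p m a b \<circ> wreath_perm p m a' b') i =
      wreath_perm p m (\<lambda>j\<in>{..<p}. a j \<circ> shift_components p m b a' j) (b \<circ> b') i"
  proof (cases "i < p * m")
    case True
    then obtain j k where i: "i = j + p * k" "j < p" "k < m" by (rule less_residues_cases)
    have "a' (b' j) permutes {1..m}" "b' j < p" using a' permutes_lessThan[OF b' i(2)] by auto
    then show ?thesis
      using i a' permutes_Suc_range[of "a' (b' j)" m k]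
      by (simp add: wreath_perm_apply shift_components_def permutes_lessThan[OF b] permutes_inverses(2)[OF b])
  qed (simp add: wreath_perm_def)
qed

lemma shift_components_closed:
  assumes "b permutes {..<p}" "a \<in> (\<Pi>\<^sub>E j\<in>{..<p}. {q. q permutes {1..m}})"
  shows "shift_components p m b a \<in> (\<Pi>\<^sub>E j\<in>{..<p}. {q. q permutes {1..m}})"
  using assms permutes_lessThan[OF permutes_inv[OF assms(1)]]
  by (auto simp: shift_components_def PiE_def Pi_def)

lemma shift_components_comp:
  assumes b: "b permutes {..<p}" and b': "b' permutes {..<p}"
    and a: "a \<in> (\<Pi>\<^sub>E j\<in>{..<p}. {q. q permutes {1..m}})"
  shows "shift_components p m (b \<circ> b') a = shift_components p m b (shift_components p m b' a)"
  using shift_components_closed[OF b' a] a permutes_lessThan[OF permutes_inv[OF b]]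
  by (auto simp: shift_components_def o_inv_distrib[OF permutes_bij[OF b] permutes_bij[OF b']])

lemma shift_components_id:
  assumes "a \<in> (\<Pi>\<^sub>E j\<in>{..<p}. {q. q permutes {1..m}})"
  shows "shift_components p m id a = a"
  using assms by (simp add: shift_components_def PiE_restrict)

text \<open>Relabelling components respects componentwise composition and is undone by relabelling
  with the inverse, so it is an automorphism of the product.\<close>

lemma shift_components_hom:
  assumes grp: "group B" and B: "carrier B \<subseteq> {b. b permutes {..<p}}" "monoid.mult B = (\<circ>)"
  shows "shift_components p m \<in> hom B (AutoGroup (product_group {..<p} (\<lambda>_. sym_group m)))"
proof -
  let ?P = "product_group {..<p} (\<lambda>_. sym_group m)"
  let ?A = "\<Pi>\<^sub>E j\<in>{..<p}. {q. q permutes {1..m}}"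
  have carr: "carrier ?P = ?A" by (simp add: sym_group_def)
  have bij: "shift_components p m b \<in> Bij ?A" if b: "b permutes {..<p}" for b
  proof -
    let ?c = "inv_into UNIV b"
    note c = permutes_inv[OF b]
    have "shift_components p m ?c (shift_components p m b a) = a"
      "shift_components p m b (shift_components p m ?c a) = a" if "a \<in> ?A" for a
      using shift_components_comp[OF c b that] shift_components_comp[OF b c that]
        shift_components_id[OF that] permutes_inv_o[OF b] by simp_all
    moreover have "shift_components p m b ` ?A \<subseteq> ?A"
      by (rule image_subsetI) (rule shift_components_closed[OF b])
    moreover have "shift_components p m ?c ` ?A \<subseteq> ?A"
      by (rule image_subsetI) (rule shift_components_closed[OF c])
    ultimately have "bij_betw (shift_components p m b) ?A ?A"
      using bij_betw_byWitness[of ?A "shift_components p m ?c" "shift_components p m b" ?A] by metis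
    then show ?thesis
      unfolding Bij_def by (auto simp: shift_components_def)
  qed
  have "shift_components p m b \<in> hom ?P ?P" if b: "b permutes {..<p}" for b
  proof (rule homI)
    fix x y assume "x \<in> carrier ?P" "y \<in> carrier ?P"
    then have xy: "x \<in> ?A" "y \<in> ?A" by (simp_all only: carr)
    have comp: "(\<lambda>j\<in>{..<p}. x j \<circ> y j) \<in> ?A" using xy by (auto intro!: permutes_compose)
    have "shift_components p m b (\<lambda>j\<in>{..<p}. x j \<circ> y j) =
        (\<lambda>j\<in>{..<p}. shift_components p m b x j \<circ> shift_components p m b y j)"
      using permutes_lessThan[OF permutes_inv[OF b]]
      by (intro ext) (simp only: shift_components_apply comp xy, simp)
    then show "shift_components p m b (x \<otimes>\<^bsub>?P\<^esub> y) = shift_components p m b x \<otimes>\<^bsub>?P\<^esub> shift_components p m b y"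
      by (simp add: sym_group_mult)
  qed (simp only: carr shift_components_closed[OF b])
  then have auto: "shift_components p m b \<in> auto ?P" if "b permutes {..<p}" for b
    using that bij by (simp add: auto_def carr del: carrier_product_group)
  show ?thesis
  proof (rule homI)
    fix b assume "b \<in> carrier B"
    then show "shift_components p m b \<in> carrier (AutoGroup ?P)"
      using auto B by (auto simp: AutoGroup_def)
  next
    fix b b' assume "b \<in> carrier B" "b' \<in> carrier B"
    then have b: "b permutes {..<p}" "b' permutes {..<p}" using B by auto
    \<comment> \<open>Multiplication in \<open>AutoGroup\<close> is the restricted
      \<open>compose\<close>, so the equation is also checked outside \<open>?A\<close>, where both
      sides are \<open>undefined\<close>.\<close>
    have "shift_components p m (b \<circ> b') = compose ?A (shift_components p m b) (shift_components p m b')"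
    proof
      fix a show "shift_components p m (b \<circ> b') a = compose ?A (shift_components p m b) (shift_components p m b') a"
      proof (cases "a \<in> ?A")
        case True
        then show ?thesis using shift_components_comp[OF b True] by (simp only: compose_def restrict_apply')
      next
        case False
        then show ?thesis by (simp only: compose_def shift_components_def restrict_apply if_False)
      qed
    qed
    then show "shift_components p m (b \<otimes>\<^bsub>B\<^esub> b') =
        shift_components p m b \<otimes>\<^bsub>AutoGroup ?P\<^esub> shift_components p m b'"
      using bij[OF b(1)] bij[OF b(2)] B
      by (simp add: AutoGroup_def BijGroup_def carr del: carrier_product_group)
  qed
qed

section \<open>The isomorphism with the split extension\<close>

theorem lemma5p1:
  fixes p n :: nat and f fi :: "bit poly"
  assumes "Factorial_Ring.prime p" and "p \<noteq> 2" and "n \<ge> 1"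
    and "f = (\<Sum>k<p. Polynomial.monom 1 k)"
    and "Factorial_Ring.irreducible fi" and "fi dvd f"
  shows "\<exists>\<phi> \<in> hom (code_aut p (cyclic_code p fi))
                  (AutoGroup (product_group {..<p} (\<lambda>_. sym_group (p ^ (n - 1))))).
           code_aut (p ^ n) (cyclic_code (p ^ n) fi) \<cong>
             semidirect (product_group {..<p} (\<lambda>_. sym_group (p ^ (n - 1))))
                        (code_aut p (cyclic_code p fi)) \<phi>"
proof -
  define m where "m = p ^ (n - 1)"
  have L: "p ^ n = p * m" using assms(3) by (simp add: m_def power_eq_if)
  have m: "m > 0" using assms(1) by (simp add: m_def prime_gt_0_nat)
  note p = assms(1,2)
  have h: "\<not> is_unit fi" "fi dvd (\<Sum>k<p. Polynomial.monom 1 k)"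
    using assms(4-6) by (auto simp: Factorial_Ring.irreducible_def)
  note hp = dvd_trans[OF h(2) geometric_sum_dvd_monom_minus_one]
  let ?P = "product_group {..<p} (\<lambda>_. sym_group m)"
  let ?A = "\<Pi>\<^sub>E j\<in>{..<p}. {q. q permutes {1..m}}"
  let ?B = "code_aut p (cyclic_code p fi)"
  let ?G = "code_aut (p * m) (cyclic_code (p * m) fi)"
  let ?S = "semidirect ?P ?B (shift_components p m)"
  have grp: "group ?B" by (rule group_code_aut) (simp add: cyclic_code_def)
  have Bperm: "b permutes {..<p}" if "b \<in> carrier ?B" for b
    using that by (simp add: code_aut_def)
  have hom: "shift_components p m \<in> hom ?B (AutoGroup ?P)"
  proof (rule shift_components_hom[OF grp])
    show "carrier ?B \<subseteq> {b. b permutes {..<p}}" using Bperm by blast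
    show "monoid.mult ?B = (\<circ>)" by (simp add: code_aut_def)
  qed
  have carr: "carrier ?S = ?A \<times> carrier ?B" by (simp add: semidirect_def sym_group_def)
  have iff: "wreath_perm p m a b \<in> carrier ?G \<longleftrightarrow> b \<in> carrier ?B" if "a \<in> ?A" "b permutes {..<p}" for a b
    using that by (intro wreath_perm_in_code_aut_iff[OF hp m]) auto
  \<comment> \<open>The isomorphism is built out of the semidirect product, where it has an explicit
    formula, and reversed at the end.\<close>
  have "(\<lambda>(a, b). wreath_perm p m a b) \<in> iso ?S ?G"
    unfolding iso_iff
  proof (intro conjI)
    show "(\<lambda>(a, b). wreath_perm p m a b) \<in> hom ?S ?G"
    proof (rule homI)
      fix x assume "x \<in> carrier ?S"
      then show "(case x of (a, b) \<Rightarrow> wreath_perm p m a b) \<in> carrier ?G"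
        using iff Bperm by (auto simp only: carr split: prod.splits)
    next
      fix x y assume "x \<in> carrier ?S" "y \<in> carrier ?S"
      then obtain a b a' b' where xy: "x = (a, b)" "y = (a', b')"
          "a \<in> ?A" "b \<in> carrier ?B" "a' \<in> ?A" "b' \<in> carrier ?B"
        by (auto simp only: carr)
      have "x \<otimes>\<^bsub>?S\<^esub> y = (\<lambda>j\<in>{..<p}. a j \<circ> shift_components p m b a' j, b \<circ> b')"
        by (simp add: xy semidirect_def sym_group_mult code_aut_def)
      then show "(case x \<otimes>\<^bsub>?S\<^esub> y of (a, b) \<Rightarrow> wreath_perm p m a b) =
          (case x of (a, b) \<Rightarrow> wreath_perm p m a b) \<otimes>\<^bsub>?G\<^esub> (case y of (a, b) \<Rightarrow> wreath_perm p m a b)"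
        using wreath_perm_comp[OF xy(3) Bperm[OF xy(4)] xy(5) Bperm[OF xy(6)]]
        by (simp add: xy(1,2)) (simp add: code_aut_def)
    qed
    show "(\<lambda>(a, b). wreath_perm p m a b) ` carrier ?S = carrier ?G"
    proof
      show "(\<lambda>(a, b). wreath_perm p m a b) ` carrier ?S \<subseteq> carrier ?G"
        using iff Bperm by (auto simp only: carr)
      show "carrier ?G \<subseteq> (\<lambda>(a, b). wreath_perm p m a b) ` carrier ?S"
      proof
        fix s assume s: "s \<in> carrier ?G"
        then obtain a b where "a \<in> ?A" "b permutes {..<p}" "s = wreath_perm p m a b"
          by (rule code_aut_wreath_permE[OF p h m])
        then show "s \<in> (\<lambda>(a, b). wreath_perm p m a b) ` carrier ?S"
          using s iff unfolding carr by force
      qed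
    qed
    show "inj_on (\<lambda>(a, b). wreath_perm p m a b) (carrier ?S)"
      unfolding carr using wreath_perm_inject[OF m] Bperm by (auto intro!: inj_onI) blast+
  qed
  then have "?S \<cong> ?G" by (rule is_isoI)
  \<comment> \<open>Reversing an isomorphism requires its source to be a group.\<close>
  moreover have "group ?S"
    using hom grp by (intro group_semidirect product_group sym_group_is_group)
  ultimately have "?G \<cong> ?S" by (rule group.iso_sym[rotated])
  then show ?thesis using hom unfolding L m_def by blast
qed

end
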